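(* Let $\tau:(0,\infty)\to\mathbb{R}$ be twice differentiable with $\tau'>0$, $\tau''<0$, $\tau(u)\to-\infty$ and $\int_1^u\tau(s)\,ds\to+\infty$ as $u\to0^+$, and let $W(u)=\int_1^u\tau(s)\,ds$. Let $\alpha,\lambda,\sigma,Y_0>0$ with $\lambda>\alpha$ satisfy $Y_0=(\lambda-\alpha)\sigma$ and $\sigma=\sqrt{(\tau(\lambda)-\tau(\alpha))/(\lambda-\alpha)}$, and let $y,y^n,\phi_n,E,B,\mu_{\pm\sigma},p_c^n$ be as in the context. Suppose $\tau_\infty:=\lim_{u\to\infty}\tau(u)<\infty$. Then the total energy of the approximate solution satisfies, for $0<t\le T_0$, $t\ne\frac{2}{n\sigma}$, $$\frac{d}{dt}E[y^n;B]=\big(\mu_{-\sigma}+\mu_\sigma+p_c^n(t)\big)\mathbf 1_{t>\frac2{n\sigma}}+e^n(t)\,\mathbf 1_{0<t<\frac2{n\sigma}},$$ with $e^n$ bounded uniformly in $n$. Accordingly, the limiting energy satisfies, for $0<t\le T_0$, $$E[y(\cdot,t);B]-E[\lambda x;B]=\int_0^t\big(\mu_{-\sigma}+\mu_\sigma+2(\tau_\infty-\tau(\alpha))Y_0\big)\,ds=:\int_0^t T\,ds>0,$$ where $\mu_{-\sigma}<0$, $\mu_\sigma<0$, $p_c:=2(\tau_\infty-\tau(\alpha))Y_0>0$, and $T>0$.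
   Context: The motion $y$ is defined by $y(x,t)=\lambda x$ for $t\le 0$ and, for $t>0$, $y(x,t)=\lambda x$ if $|x|>\sigma t$, $y(x,t)=-tY_0+\alpha x$ if $-\sigma t<x<0$, and $y(x,t)=tY_0+\alpha x$ if $0<x<\sigma t$. For a mollifier $\phi\in C_c^\infty(\mathbb{R})$, $\phi\ge0$, $\phi(-x)=\phi(x)$, $\operatorname{supp}\phi\subset B_1$ (the ball of radius 1), $\int\phi=1$, set $\phi_n(x)=n\phi(nx)$ and $y^n(x,t)=\int_{\mathbb{R}}\phi_n(x-z)y(z,t)\,dz$. Fix $T_0>0$ and $B=(-r,r)$ with $r>\sigma T_0+1$, so that $B$ contains the whole wave fan of $y^n$ for $0<t\le T_0$. Energies: $$E[y^n;B]=\int_B\tfrac12(\partial_ty^n)^2+W(\partial_xy^n)\,dx,\qquad E[y;B]=\lim_{n\to\infty}E[y^n;B],\qquad E[\lambda x;B]=\int_BW(\lambda)\,dx .$$ The (rates of) dissipation of the shocks at $x=\pm\sigma t$ are $$\mu_\sigma=\mu_{-\sigma}=\sigma\Big[\tfrac12Y_0^2+W(\alpha)-W(\lambda)\Big]+Y_0\tau(\alpha),$$ and the rate of work at the crack is, for $t>\frac2{n\sigma}$, $$p_c^n(t)=\int_{-1/n}^{1/n}\tau\big(\alpha+2\phi_n(x)tY_0\big)\,2Y_0\,\phi_n(x)\,dx-2Y_0\tau(\alpha).$$ $\mathbf 1_A$ equals $1$ if $A$ holds and $0$ otherwise. *)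

theory Defs
  imports "HOL-Analysis.Analysis"
begin

text \<open>Signed interval integral: for \<^term>\<open>u < 1\<close> this is minus the integral over
  the interval from \<^term>\<open>u\<close> to \<^term>\<open>1\<close>.\<close>

definition stored_energy :: "(real \<Rightarrow> real) \<Rightarrow> real \<Rightarrow> real" where
  "stored_energy \<tau> u = (LBINT s=ereal 1..ereal u. \<tau> s)"

definition smooth :: "(real \<Rightarrow> real) \<Rightarrow> bool" where
  "smooth f \<longleftrightarrow> (\<forall>k x. (deriv ^^ k) f differentiable (at x))"

text \<open>The support is allowed to be all of the closed unit interval, so that the standard
  bump function is included; this subsumes support in the open ball.\<close>

definition mollifier :: "(real \<Rightarrow> real) \<Rightarrow> bool" where
  "mollifier \<phi> \<longleftrightarrow>
     smooth \<phi> \<and> (\<forall>x. 0 \<le> \<phi> x) \<and> (\<forall>x. \<phi> (- x) = \<phi> x) \<and>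
     closure {x. \<phi> x \<noteq> 0} \<subseteq> cball 0 1 \<and> (LINT x|lborel. \<phi> x) = 1"

definition rescaled :: "(real \<Rightarrow> real) \<Rightarrow> nat \<Rightarrow> real \<Rightarrow> real" where
  "rescaled \<phi> n x = real n * \<phi> (real n * x)"

text \<open>For \<^term>\<open>t > 0\<close> the mathematical definition leaves the values at \<open>x = 0\<close> and
  \<open>x = \<plusminus>\<sigma>t\<close> open.  The choice made here is immaterial, since the motion is only used inside
  the convolution \<open>mollified\<close>.\<close>

definition motion :: "real \<Rightarrow> real \<Rightarrow> real \<Rightarrow> real \<Rightarrow> real \<Rightarrow> real \<Rightarrow> real" where
  "motion \<alpha> lam \<sigma> Y0 x t =
     (if t \<le> 0 \<or> \<sigma> * t \<le> \<bar>x\<bar> then lam * x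
      else if x < 0 then - t * Y0 + \<alpha> * x
      else t * Y0 + \<alpha> * x)"

definition mollified ::
    "(real \<Rightarrow> real) \<Rightarrow> nat \<Rightarrow> (real \<Rightarrow> real \<Rightarrow> real) \<Rightarrow> real \<Rightarrow> real \<Rightarrow> real" where
  "mollified \<phi> n y x t = (LINT z|lborel. rescaled \<phi> n (x - z) * y z t)"

definition energy ::
    "(real \<Rightarrow> real) \<Rightarrow> (real \<Rightarrow> real \<Rightarrow> real) \<Rightarrow> real set \<Rightarrow> real \<Rightarrow> real" where
  "energy \<tau> u B t =
     (LINT x:B|lborel. 1/2 * (deriv (\<lambda>s. u x s) t)\<^sup>2 + stored_energy \<tau> (deriv (\<lambda>\<xi>. u \<xi> t) x))"

text \<open>The motion \<^term>\<open>y\<close> may be discontinuous in \<^term>\<open>x\<close>, so its energy is the limit of the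
  energies of its mollifications.\<close>

definition limit_energy ::
    "(real \<Rightarrow> real) \<Rightarrow> (real \<Rightarrow> real) \<Rightarrow> (real \<Rightarrow> real \<Rightarrow> real) \<Rightarrow> real set \<Rightarrow> real \<Rightarrow> real" where
  "limit_energy \<tau> \<phi> y B t = lim (\<lambda>n. energy \<tau> (mollified \<phi> n y) B t)"

definition homogeneous_energy :: "(real \<Rightarrow> real) \<Rightarrow> real \<Rightarrow> real set \<Rightarrow> real" where
  "homogeneous_energy \<tau> lam B = (LINT x:B|lborel. stored_energy \<tau> lam)"

definition mu_right :: "(real \<Rightarrow> real) \<Rightarrow> real \<Rightarrow> real \<Rightarrow> real \<Rightarrow> real \<Rightarrow> real" where
  "mu_right \<tau> \<alpha> lam \<sigma> Y0 =
     \<sigma> * (1/2 * Y0\<^sup>2 + stored_energy \<tau> \<alpha> - stored_energy \<tau> lam) + Y0 * \<tau> \<alpha>"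

definition mu_left :: "(real \<Rightarrow> real) \<Rightarrow> real \<Rightarrow> real \<Rightarrow> real \<Rightarrow> real \<Rightarrow> real" where
  "mu_left \<tau> \<alpha> lam \<sigma> Y0 =
     \<sigma> * (1/2 * Y0\<^sup>2 + stored_energy \<tau> \<alpha> - stored_energy \<tau> lam) + Y0 * \<tau> \<alpha>"

definition crack_power ::
    "(real \<Rightarrow> real) \<Rightarrow> (real \<Rightarrow> real) \<Rightarrow> real \<Rightarrow> real \<Rightarrow> nat \<Rightarrow> real \<Rightarrow> real" where
  "crack_power \<tau> \<phi> \<alpha> Y0 n t =
     (LINT x:{- 1 / real n..1 / real n}|lborel.
        \<tau> (\<alpha> + 2 * rescaled \<phi> n x * t * Y0) * (2 * Y0 * rescaled \<phi> n x))
     - 2 * Y0 * \<tau> \<alpha>"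

definition limit_crack_power :: "(real \<Rightarrow> real) \<Rightarrow> real \<Rightarrow> real \<Rightarrow> real \<Rightarrow> real" where
  "limit_crack_power \<tau> \<tau>_inf \<alpha> Y0 = 2 * (\<tau>_inf - \<tau> \<alpha>) * Y0"

definition total_rate ::
    "(real \<Rightarrow> real) \<Rightarrow> real \<Rightarrow> real \<Rightarrow> real \<Rightarrow> real \<Rightarrow> real \<Rightarrow> real" where
  "total_rate \<tau> \<tau>_inf \<alpha> lam \<sigma> Y0 =
     mu_left \<tau> \<alpha> lam \<sigma> Y0 + mu_right \<tau> \<alpha> lam \<sigma> Y0 + limit_crack_power \<tau> \<tau>_inf \<alpha> Y0"

end

theory Submission
  imports Defs
begin

text \<open>For \<open>t > 0\<close> the mollified motion is explicit in terms of the kernel's distribution function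
  \<open>R\<close> and an antiderivative of \<open>R\<close>, and its strain never drops below \<open>\<alpha>\<close>, so that only bounded values
  of \<open>\<tau>\<close> occur.  Differentiating under the integral sign gives \<open>dE/dt\<close> for all \<open>t > 0\<close> with a bound
  independent of \<open>n\<close>.  Once \<open>\<sigma>t > 2/n\<close>, the kernels centred at \<open>0\<close> and \<open>\<plusminus>\<sigma>t\<close> have disjoint
  supports: up to the crack term the integrand is an exact \<open>x\<close>-derivative, whose boundary values are
  the shock dissipations.  The crack term is rescaled to the unit interval and converges by dominated
  convergence; integrating the bounded rates in time and using dominated convergence again yields the
  limiting energy.  Since \<open>\<sigma>\<^sup>2(\<lambda> - \<alpha>) = \<tau>(\<lambda>) - \<tau>(\<alpha>)\<close>, the sign of \<open>\<mu>\<close> is that of the trapezoidal rule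
  error for the strictly concave \<open>\<tau>\<close>.\<close>

section \<open>Signed integrals as antiderivatives\<close>

lemma interval_integral_has_real_derivative:
  fixes f :: "real \<Rightarrow> real"
  assumes "open S" "is_interval S" "continuous_on S f" "c \<in> S" "x \<in> S"
  shows "((\<lambda>u. LBINT s=ereal c..ereal u. f s) has_real_derivative f x) (at x)"
proof -
  obtain e where e: "e > 0" "cball x e \<subseteq> S"
    using assms open_contains_cball by blast
  \<comment> \<open>\<open>{a..b}\<close> is the hull of \<open>c\<close> and a ball around
    \<open>x\<close>: it has \<open>x\<close> in its interior on whichever side of \<open>c\<close>
    that lies, and it stays in \<open>S\<close> because \<open>S\<close> is an interval.\<close>
  define a b where "a = min c (x - e)" and "b = max c (x + e)"
  have "x - e \<in> S" "x + e \<in> S"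
    using e by (auto simp: dist_real_def intro!: subsetD[OF e(2)])
  then have "a \<in> S" "b \<in> S"
    using \<open>c \<in> S\<close> by (auto simp: a_def b_def min_def max_def)
  then have sub: "{a..b} \<subseteq> S"
    using \<open>is_interval S\<close> unfolding is_interval_1 by (meson atLeastAtMost_iff subsetI)
  have ab: "a < x" "x < b" "a \<le> c" "c \<le> b"
    using e by (auto simp: a_def b_def)
  have "((\<lambda>u. LBINT s=ereal c..ereal u. f s) has_vector_derivative f x) (at x within {a..b})"
    using ab sub assms by (intro interval_integral_FTC2) (auto intro: continuous_on_subset)
  then show ?thesis
    using ab by (simp add: has_real_derivative_iff_has_vector_derivative at_within_Icc_at)
qed

section \<open>Even kernels of compact support and their convolution with the motion\<close>

locale kernel =
  fixes \<rho> :: "real \<Rightarrow> real" and \<epsilon> :: real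
  assumes continuous: "continuous_on UNIV \<rho>"
    and nonneg: "0 \<le> \<rho> x"
    and even: "\<rho> (- x) = \<rho> x"
    and vanish: "\<epsilon> < \<bar>x\<bar> \<Longrightarrow> \<rho> x = 0"
    and total: "(LINT x|lborel. \<rho> x) = 1"
    and radius: "0 < \<epsilon>"
begin

definition cdf :: "real \<Rightarrow> real" where
  "cdf x = (LBINT s=ereal (- \<epsilon>)..ereal x. \<rho> s)"

text \<open>Convolution with an affine piece integrates \<open>\<rho>\<close> twice. Only
  differences of values enter, so the base point 0 is a free choice.\<close>

definition cdf2 :: "real \<Rightarrow> real" where
  "cdf2 x = (LBINT s=ereal 0..ereal x. cdf s)"

lemma DERIV_cdf: "(cdf has_real_derivative \<rho> x) (at x)"
  unfolding cdf_def using continuous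
  by (intro interval_integral_has_real_derivative[of UNIV]) auto

lemma continuous_on_rho [continuous_intros]:
  "continuous_on A f \<Longrightarrow> continuous_on A (\<lambda>x. \<rho> (f x))"
  by (rule continuous_on_compose2[OF continuous, of A f]) auto

lemma continuous_on_cdf [continuous_intros]:
  assumes "continuous_on A f"
  shows "continuous_on A (\<lambda>x. cdf (f x))"
proof (rule continuous_on_compose2[of UNIV cdf A f])
  show "continuous_on UNIV cdf"
    by (rule DERIV_continuous_on[of _ cdf \<rho>])
      (rule has_field_derivative_at_within[OF DERIV_cdf])
qed (use assms in auto)

lemma DERIV_cdf2: "(cdf2 has_real_derivative cdf x) (at x)"
  unfolding cdf2_def
  using continuous_on_cdf[OF continuous_on_id]
  by (intro interval_integral_has_real_derivative[of UNIV]) auto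

lemmas cdf_derivs [derivative_intros] =
  DERIV_chain2[OF DERIV_cdf] DERIV_chain2[OF DERIV_cdf2]

lemma support: "\<rho> x \<noteq> 0 \<Longrightarrow> \<bar>x\<bar> \<le> \<epsilon>"
  using vanish[of x] by linarith

lemma cdf_radius: "cdf \<epsilon> = 1"
proof -
  have "cdf \<epsilon> = (LBINT s:{- \<epsilon>..\<epsilon>}. \<rho> s)"
    unfolding cdf_def using radius by (subst interval_integral_Icc) auto
  also have "\<dots> = (LINT s|lborel. \<rho> s)"
    unfolding set_lebesgue_integral_def using support
    by (intro Bochner_Integration.integral_cong) (auto simp: indicator_def abs_le_iff minus_le_iff)
  finally show ?thesis using total by simp
qed

lemma cdf_eq_0: assumes "x \<le> - \<epsilon>" shows "cdf x = 0"
proof -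
  \<comment> \<open>The left end \<open>x - 1\<close> keeps the interval nondegenerate when
    \<open>x = - \<epsilon>\<close>; the common value is read off at \<open>- \<epsilon>\<close>,
    where the integral is empty.\<close>
  have *: "cdf z = cdf (x - 1)" if "x - 1 \<le> z" "z \<le> - \<epsilon>" for z
  proof (rule DERIV_isconst2[of "x - 1" "- \<epsilon>"])
    show "(cdf has_real_derivative 0) (at w)" if "x - 1 < w" "w < - \<epsilon>" for w
      using DERIV_cdf[of w] vanish[of w] that radius by simp
  qed (use assms that continuous_on_cdf[OF continuous_on_id] in auto)
  show ?thesis
    using *[of x] *[of "- \<epsilon>"] assms by (simp add: cdf_def)
qed

text \<open>Evenness makes \<open>cdf x + cdf (- x)\<close> constant, and at
  \<open>\<epsilon>\<close> it equals the total mass.\<close>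

lemma cdf_reflect: "cdf (- x) = 1 - cdf x"
proof -
  have "((\<lambda>x. cdf x + cdf (- x)) has_real_derivative 0) (at x)" for x
    by (auto intro!: derivative_eq_intros simp: even)
  then have "cdf x + cdf (- x) = cdf \<epsilon> + cdf (- \<epsilon>)"
    by (intro DERIV_isconst_all) auto
  then show ?thesis using cdf_radius cdf_eq_0[of "- \<epsilon>"] by simp
qed

lemma cdf_eq_1: "\<epsilon> \<le> x \<Longrightarrow> cdf x = 1"
  using cdf_eq_0[of "- x"] cdf_reflect[of x] by simp

lemma cdf_mono: "x \<le> y \<Longrightarrow> cdf x \<le> cdf y"
  using DERIV_nonneg_imp_nondecreasing[of x y cdf] DERIV_cdf nonneg by blast

lemma cdf_nonneg: "0 \<le> cdf x"
  using cdf_mono[of "min x (- \<epsilon>)" x] cdf_eq_0[of "min x (- \<epsilon>)"] by simp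

lemma cdf_le_1: "cdf x \<le> 1"
  using cdf_nonneg[of "- x"] cdf_reflect[of x] by simp

lemma cdf_diff_le: "cdf x - cdf y \<le> 1"
  using cdf_le_1[of x] cdf_nonneg[of y] by linarith

text \<open>Encodes the vanishing first moment of an even kernel: this is why mollification
  reproduces linear functions.\<close>

lemma cdf2_radius: "cdf2 \<epsilon> - cdf2 (- \<epsilon>) = \<epsilon>"
proof -
  have "((\<lambda>x. cdf2 x - cdf2 (- x) - x) has_real_derivative 0) (at x)" for x
    by (auto intro!: derivative_eq_intros simp: cdf_reflect)
  then have "cdf2 \<epsilon> - cdf2 (- \<epsilon>) - \<epsilon> = cdf2 0 - cdf2 (- 0) - 0"
    by (intro DERIV_isconst_all) auto
  then show ?thesis by simp
qed

lemma has_integral_shifted: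
  assumes "a \<le> b"
  shows "((\<lambda>x. \<rho> (x + c)) has_integral cdf (b + c) - cdf (a + c)) {a..b}"
  using assms
  by (intro fundamental_theorem_of_calculus)
    (auto intro!: derivative_eq_intros simp flip: has_real_derivative_iff_has_vector_derivative)

text \<open>Integration by parts in \<open>z\<close>. The value is a separate equation, so that each
  use can supply its own simplified form.\<close>

lemma has_bochner_integral_affine:
  assumes "p \<le> q"
    and "v = cdf (x - p) * (a * p + b) + a * cdf2 (x - p)
      - (cdf (x - q) * (a * q + b) + a * cdf2 (x - q))"
  shows "has_bochner_integral lborel (\<lambda>z. \<rho> (x - z) * (a * z + b) * indicator {p..q} z) v"
proof -
  have "((\<lambda>z. - (cdf (x - z) * (a * z + b) + a * cdf2 (x - z))) has_real_derivative
      \<rho> (x - z) * (a * z + b)) (at z)" for z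
    by (auto intro!: derivative_eq_intros simp: algebra_simps)
  moreover have "continuous_on UNIV (\<lambda>z. \<rho> (x - z) * (a * z + b))"
    by (intro continuous_intros)
  then have "isCont (\<lambda>z. \<rho> (x - z) * (a * z + b)) z" for z
    by (simp add: continuous_on_eq_continuous_at)
  ultimately have "has_bochner_integral lborel
      (\<lambda>z. \<rho> (x - z) * (a * z + b) * indicator {p..q} z)
      (- (cdf (x - q) * (a * q + b) + a * cdf2 (x - q)) -
      - (cdf (x - p) * (a * p + b) + a * cdf2 (x - p)))"
    using assms by (intro has_bochner_integral_FTC_Icc_real) auto
  then show ?thesis
    unfolding assms(2) by (simp add: algebra_simps)
qed

text \<open>The motion is \<open>lam * z\<close> plus an affine correction on each half of the fan.
  The jump across 0 produces the \<open>cdf x\<close> term; the slope change from \<open>lam\<close>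
  to \<open>\<alpha>\<close> produces the \<open>cdf2\<close> terms.\<close>

lemma convolution_motion:
  assumes "0 < t" "0 \<le> \<sigma>" "Y0 = (lam - \<alpha>) * \<sigma>"
  shows "(LINT z|lborel. \<rho> (x - z) * motion \<alpha> lam \<sigma> Y0 z t) =
    lam * x + 2 * t * Y0 * cdf x - (lam - \<alpha>) * (cdf2 (x + \<sigma> * t) - cdf2 (x - \<sigma> * t))"
proof -
  let ?I = "\<lambda>p q a b z. \<rho> (x - z) * (a * z + b) * indicator {p..q} z"
  \<comment> \<open>The linear part is cut off to the support of the kernel, since the affine
    formula is for bounded intervals.\<close>
  have 1: "has_bochner_integral lborel (?I (x - \<epsilon>) (x + \<epsilon>) lam 0) (lam * x)"
    using radius arg_cong[OF cdf2_radius, of "(*) lam"]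
    by (intro has_bochner_integral_affine)
      (simp_all add: cdf_eq_0 cdf_radius right_diff_distrib left_diff_distrib)
  have st: "0 \<le> \<sigma> * t" using assms by simp
  have 2: "has_bochner_integral lborel (?I (- (\<sigma> * t)) 0 (\<alpha> - lam) (- t * Y0))
      (t * Y0 * cdf x - (lam - \<alpha>) * (cdf2 (x + \<sigma> * t) - cdf2 x))"
    using st by (intro has_bochner_integral_affine) (simp_all add: assms(3) algebra_simps)
  have 3: "has_bochner_integral lborel (?I 0 (\<sigma> * t) (\<alpha> - lam) (t * Y0))
      (t * Y0 * cdf x - (lam - \<alpha>) * (cdf2 x - cdf2 (x - \<sigma> * t)))"
    using st by (intro has_bochner_integral_affine) (simp_all add: assms(3) algebra_simps)
  let ?s = "\<lambda>z. ?I (x - \<epsilon>) (x + \<epsilon>) lam 0 z + ?I (- (\<sigma> * t)) 0 (\<alpha> - lam) (- t * Y0) z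
      + ?I 0 (\<sigma> * t) (\<alpha> - lam) (t * Y0) z"
  have sum: "has_bochner_integral lborel ?s
      (lam * x + (t * Y0 * cdf x - (lam - \<alpha>) * (cdf2 (x + \<sigma> * t) - cdf2 x))
        + (t * Y0 * cdf x - (lam - \<alpha>) * (cdf2 x - cdf2 (x - \<sigma> * t))))"
    by (intro has_bochner_integral_add 1 2 3)
  \<comment> \<open>At \<open>z = 0\<close> both indicators are 1 and the corrections cancel,
    whereas \<open>motion\<close> takes the right-hand value there; this null set is left
    out.\<close>
  have ne0: "\<rho> (x - z) * motion \<alpha> lam \<sigma> Y0 z t = ?s z" if "z \<noteq> 0" for z
  proof (cases "\<bar>x - z\<bar> \<le> \<epsilon>")
    case True
    then have z: "z \<in> {x - \<epsilon>..x + \<epsilon>}" by auto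
    have m: "motion \<alpha> lam \<sigma> Y0 z t = lam * z
        + ((\<alpha> - lam) * z + (- t * Y0)) * indicator {- (\<sigma> * t)..0} z
        + ((\<alpha> - lam) * z + t * Y0) * indicator {0..\<sigma> * t} z"
    proof -
      \<comment> \<open>The corrections vanish at the fronts: the relation for \<open>Y0\<close>
        makes the motion continuous across \<open>\<plusminus>\<sigma>t\<close>, so the closed
        indicators agree with \<open>motion\<close> there.\<close>
      have v: "(\<alpha> - lam) * (\<sigma> * t) + t * Y0 = 0" by (simp add: assms(3) algebra_simps)
      consider "\<sigma> * t < \<bar>z\<bar>" | "z = \<sigma> * t" | "z = - (\<sigma> * t)" | "\<bar>z\<bar> < \<sigma> * t"
        by linarith
      then show ?thesis
      proof cases
        case 1
        then show ?thesis using st by (auto simp: motion_def indicator_def)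
      next
        case 2
        then show ?thesis using st that v by (auto simp: motion_def indicator_def)
      next
        case 3
        then show ?thesis using st that v
          by (auto simp: motion_def indicator_def)
      next
        case 4
        then show ?thesis using that assms(1)
          by (cases "z < 0") (auto simp: motion_def indicator_def algebra_simps)
      qed
    qed
    show ?thesis unfolding m using z by (simp add: algebra_simps)
  qed (simp add: vanish)
  have ae: "AE z in lborel. \<rho> (x - z) * motion \<alpha> lam \<sigma> Y0 z t = ?s z"
    using AE_lborel_singleton[of "0 :: real"] by (rule AE_mp) (intro AE_I2 impI ne0)
  have "(LINT z|lborel. \<rho> (x - z) * motion \<alpha> lam \<sigma> Y0 z t) = (LINT z|lborel. ?s z)"
  proof (rule integral_cong_AE[OF _ _ ae])
    have [measurable]: "\<rho> \<in> borel_measurable borel"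
      using continuous by (simp add: borel_measurable_continuous_onI)
    show "(\<lambda>z. \<rho> (x - z) * motion \<alpha> lam \<sigma> Y0 z t) \<in> borel_measurable lborel"
      unfolding motion_def by measurable
    show "?s \<in> borel_measurable lborel"
      using sum has_bochner_integral_iff borel_measurable_integrable by blast
  qed
  with has_bochner_integral_integral_eq[OF sum] show ?thesis
    by (simp add: algebra_simps)
qed

end

section \<open>Bounds on the stress from monotonicity and the finite limit\<close>

locale bar =
  fixes \<tau> :: "real \<Rightarrow> real" and \<alpha> lam \<sigma> Y0 \<tau>_inf :: real
  assumes tau_continuous: "continuous_on {0<..} \<tau>"
    and tau_less: "0 < u \<Longrightarrow> u < v \<Longrightarrow> \<tau> u < \<tau> v"
    and tau_tendsto: "(\<tau> \<longlongrightarrow> \<tau>_inf) at_top"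
    and alpha_pos: "0 < \<alpha>" and alpha_less: "\<alpha> < lam" and sigma_pos: "0 < \<sigma>"
    and Y0_eq: "Y0 = (lam - \<alpha>) * \<sigma>"
begin

lemma Y0_pos: "0 < Y0"
  using alpha_less sigma_pos by (simp add: Y0_eq)

lemma DERIV_stored_energy:
  "0 < u \<Longrightarrow> (stored_energy \<tau> has_real_derivative \<tau> u) (at u)"
  unfolding stored_energy_def using tau_continuous
  by (intro interval_integral_has_real_derivative[of "{0<..}"]) (auto simp: is_interval_1)

lemma tau_le_inf: "0 < u \<Longrightarrow> \<tau> u \<le> \<tau>_inf"
proof (rule tendsto_lowerbound[OF tau_tendsto])
  assume "0 < u"
  then show "\<forall>\<^sub>F v in at_top. \<tau> u \<le> \<tau> v"
    by (intro eventually_mono[OF eventually_gt_at_top[of u]] less_imp_le tau_less)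
qed simp

lemma tau_mono: "0 < u \<Longrightarrow> u \<le> v \<Longrightarrow> \<tau> u \<le> \<tau> v"
  using tau_less[of u v] by (cases "u = v") auto

text \<open>Strains above \<open>\<alpha>\<close> stay away from 0, so monotonicity traps the stress
  between \<open>\<tau> \<alpha>\<close> and its limit.\<close>

lemma abs_tau_le: assumes "\<alpha> \<le> u" shows "\<bar>\<tau> u\<bar> \<le> max \<bar>\<tau> \<alpha>\<bar> \<bar>\<tau>_inf\<bar>"
  using tau_le_inf[of u] tau_mono[of \<alpha> u] assms alpha_pos by linarith

text \<open>Depends on the material and wave data only, not on a kernel or a time; hence it serves
  as a bound uniform in \<open>n\<close>.\<close>

definition rate_bound :: real where
  "rate_bound = (let M = max \<bar>\<tau> \<alpha>\<bar> \<bar>\<tau>_inf\<bar> in 2 * (2 * Y0\<^sup>2 * \<sigma> + M * Y0) + 2 * M * Y0)"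

end

section \<open>Explicit fields of the mollified wave fan and the energy rate\<close>

locale fan = kernel + bar
begin

text \<open>The closed form from \<open>convolution_motion\<close>, taken as a formula for every
  \<open>t\<close>. At \<open>t = 0\<close> it is \<open>lam * x\<close>, so the energy extends
  smoothly to the initial time.\<close>

definition position :: "real \<Rightarrow> real \<Rightarrow> real" where
  "position t x =
    lam * x + 2 * t * Y0 * cdf x - (lam - \<alpha>) * (cdf2 (x + \<sigma> * t) - cdf2 (x - \<sigma> * t))"

definition strain :: "real \<Rightarrow> real \<Rightarrow> real" where
  "strain t x = lam + 2 * t * Y0 * \<rho> x - (lam - \<alpha>) * (cdf (x + \<sigma> * t) - cdf (x - \<sigma> * t))"

definition strain_rate :: "real \<Rightarrow> real \<Rightarrow> real" where
  "strain_rate t x = Y0 * (2 * \<rho> x - \<rho> (x + \<sigma> * t) - \<rho> (x - \<sigma> * t))"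

definition velocity :: "real \<Rightarrow> real \<Rightarrow> real" where
  "velocity t x = Y0 * (2 * cdf x - cdf (x + \<sigma> * t) - cdf (x - \<sigma> * t))"

definition acceleration :: "real \<Rightarrow> real \<Rightarrow> real" where
  "acceleration t x = Y0 * \<sigma> * (\<rho> (x - \<sigma> * t) - \<rho> (x + \<sigma> * t))"

definition energy_density :: "real \<Rightarrow> real \<Rightarrow> real" where
  "energy_density t x = 1/2 * (velocity t x)\<^sup>2 + stored_energy \<tau> (strain t x)"

definition energy_rate :: "real \<Rightarrow> real \<Rightarrow> real" where
  "energy_rate t x = velocity t x * acceleration t x + \<tau> (strain t x) * strain_rate t x"

text \<open>The crack term only adds strain, and the fan term removes at most
  \<open>lam - \<alpha>\<close>, since a difference of \<open>cdf\<close> values is at most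
  1.\<close>

lemma strain_ge: assumes "0 \<le> t" shows "\<alpha> \<le> strain t x"
proof -
  define d where "d = (lam - \<alpha>) * (cdf (x + \<sigma> * t) - cdf (x - \<sigma> * t))"
  have "d \<le> (lam - \<alpha>) * 1"
    unfolding d_def
    using alpha_less cdf_le_1[of "x + \<sigma> * t"] cdf_nonneg[of "x - \<sigma> * t"]
    by (intro mult_left_mono) linarith+
  moreover have "0 \<le> 2 * t * Y0 * \<rho> x"
    using assms Y0_pos nonneg by simp
  ultimately have "0 \<le> 2 * t * Y0 * \<rho> x + (lam - \<alpha> - d)" by simp
  then show ?thesis unfolding strain_def d_def[symmetric] by (simp add: algebra_simps)
qed

lemma strain_pos: "0 \<le> t \<Longrightarrow> 0 < strain t x"
  using strain_ge[of t x] alpha_pos by linarith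

lemma DERIV_position_space: "((\<lambda>x. position t x) has_real_derivative strain t x) (at x)"
  unfolding position_def strain_def by (auto intro!: derivative_eq_intros)

lemma DERIV_position_time: "((\<lambda>t. position t x) has_real_derivative velocity t x) (at t)"
  unfolding position_def velocity_def
  by (auto intro!: derivative_eq_intros simp: Y0_eq algebra_simps)

lemma DERIV_velocity: "((\<lambda>t. velocity t x) has_real_derivative acceleration t x) (at t)"
  unfolding velocity_def acceleration_def
  by (auto intro!: derivative_eq_intros simp: algebra_simps)

lemma DERIV_strain: "((\<lambda>t. strain t x) has_real_derivative strain_rate t x) (at t)"
  unfolding strain_def strain_rate_def
  by (auto intro!: derivative_eq_intros simp: Y0_eq algebra_simps)

lemma DERIV_energy_density:
  "0 \<le> t \<Longrightarrow> ((\<lambda>t. energy_density t x) has_real_derivative energy_rate t x) (at t)"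
  unfolding energy_density_def energy_rate_def
  by (auto intro!: derivative_eq_intros DERIV_velocity DERIV_strain
      DERIV_chain2[OF DERIV_stored_energy] strain_pos)

lemma continuous_on_strain [continuous_intros]:
  "continuous_on A f \<Longrightarrow> continuous_on A g \<Longrightarrow> continuous_on A (\<lambda>z. strain (f z) (g z))"
  unfolding strain_def by (intro continuous_intros)

lemma continuous_on_energy_density:
  assumes "0 \<le> t" shows "continuous_on A (energy_density t)"
proof -
  have "continuous_on {0<..} (stored_energy \<tau>)"
    by (rule DERIV_continuous_on[of _ _ \<tau>])
      (auto intro: has_field_derivative_at_within DERIV_stored_energy)
  then have "continuous_on A (\<lambda>x. stored_energy \<tau> (strain t x))"
    by (rule continuous_on_compose2)
      (use assms strain_pos in \<open>auto intro!: continuous_intros\<close>)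
  then show ?thesis
    unfolding energy_density_def[abs_def] velocity_def by (intro continuous_intros)
qed

lemma continuous_on_energy_rate:
  "continuous_on ({0..} \<times> A) (\<lambda>(t, x). energy_rate t x)"
proof -
  have "continuous_on ({0..} \<times> A) (\<lambda>z. \<tau> (strain (fst z) (snd z)))"
    by (rule continuous_on_compose2[OF tau_continuous])
      (use strain_pos in \<open>auto intro!: continuous_intros\<close>)
  then show ?thesis
    unfolding energy_rate_def velocity_def acceleration_def strain_rate_def split_beta
    by (intro continuous_intros)
qed

lemma energy_rate_integrable:
  assumes "0 \<le> t" shows "energy_rate t integrable_on {a..b}"
proof (rule integrable_continuous_real)
  have "continuous_on {a..b} ((\<lambda>(t, x). energy_rate t x) \<circ> Pair t)"
    using assms by (intro continuous_on_compose continuous_intros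
        continuous_on_subset[OF continuous_on_energy_rate[of UNIV]]) auto
  then show "continuous_on {a..b} (energy_rate t)" by (simp add: o_def)
qed

text \<open>Leibniz rule on the closed half-line, so that integration in time can start at
  0.\<close>

lemma DERIV_integral_energy_density:
  assumes "0 \<le> t"
  shows "((\<lambda>t. integral {a..b} (energy_density t)) has_real_derivative
    integral {a..b} (energy_rate t)) (at t within {0..})"
proof -
  have "((\<lambda>t. integral (cbox a b) (energy_density t)) has_real_derivative
    integral (cbox a b) (energy_rate t)) (at t within {0..})"
    using assms continuous_on_energy_rate
    by (intro leibniz_rule_field_derivative)
      (auto intro: has_field_derivative_at_within DERIV_energy_density
        integrable_continuous_real continuous_on_energy_density)
  then show ?thesis by simp
qed

text \<open>Agreement with \<open>position\<close> is asked for at positive times only; this open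
  set of times suffices for both partial derivatives at \<open>t > 0\<close>.\<close>

lemma energy_eq:
  assumes "0 < t" and u: "\<And>s x. 0 < s \<Longrightarrow> u x s = position s x"
  shows "energy \<tau> u {- r<..<r} t = integral {- r..r} (energy_density t)"
proof -
  have "((\<lambda>s. u x s) has_real_derivative velocity t x) (at t)" for x
    using assms(1)
    by (intro has_field_derivative_transform_within_open[OF DERIV_position_time, of "{0<..}"])
      (auto simp: u)
  then have "deriv (\<lambda>s. u x s) t = velocity t x" for x
    by (rule DERIV_imp_deriv)
  moreover have "deriv (\<lambda>\<xi>. u \<xi> t) x = strain t x" for x
    using assms by (intro DERIV_imp_deriv) (simp add: DERIV_position_space)
  ultimately have "energy \<tau> u {- r<..<r} t = (LINT x:{- r<..<r}|lborel. energy_density t x)"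
    by (simp add: energy_def energy_density_def)
  also have "\<dots> = integral {- r<..<r} (energy_density t)"
  proof (rule set_borel_integral_eq_integral(2))
    have "set_integrable lborel {- r..r} (energy_density t)"
      using assms(1) by (intro borel_integrable_atLeastAtMost' continuous_on_energy_density) simp
    then show "set_integrable lborel {- r<..<r} (energy_density t)"
      by (rule set_integrable_subset) auto
  qed
  also have "\<dots> = integral {- r..r} (energy_density t)"
    using integral_open_interval[of "- r" r "energy_density t"] by simp
  finally show ?thesis .
qed

text \<open>Every term is a bounded factor (velocity or stress) times a shifted kernel. A kernel has
  integral at most 1 over any interval, however tall it is, so the radius drops out.\<close>

lemma abs_integral_energy_rate_le:
  assumes "0 \<le> t" "a \<le> b"
  shows "\<bar>integral {a..b} (energy_rate t)\<bar> \<le> rate_bound"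
proof -
  define M where "M = max \<bar>\<tau> \<alpha>\<bar> \<bar>\<tau>_inf\<bar>"
  have M: "0 \<le> M" by (simp add: M_def)
  define k where "k = 2 * Y0\<^sup>2 * \<sigma> + M * Y0"
  have k: "0 \<le> k" using M Y0_pos sigma_pos by (simp add: k_def)
  \<comment> \<open>The weight \<open>k\<close> at each front collects velocity times acceleration
    and stress times strain rate. The arguments \<open>x + - \<sigma> * t\<close> and
    \<open>x + 0\<close> fit the shape of \<open>has_integral_shifted\<close>.\<close>
  define g where "g = (\<lambda>x. k * \<rho> (x + \<sigma> * t) + k * \<rho> (x + - \<sigma> * t) + 2 * M * Y0 * \<rho> (x + 0))"
  have g: "(g has_integral k * (cdf (b + \<sigma> * t) - cdf (a + \<sigma> * t))
      + k * (cdf (b + - \<sigma> * t) - cdf (a + - \<sigma> * t)) + 2 * M * Y0 * (cdf (b + 0) - cdf (a + 0))) {a..b}"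
    unfolding g_def
    by (intro has_integral_add has_integral_mult_right has_integral_shifted assms)
  have "norm (integral {a..b} (energy_rate t)) \<le> integral {a..b} g"
  proof (rule integral_norm_bound_integral)
    fix x
    have v: "\<bar>velocity t x\<bar> \<le> 2 * Y0"
    proof -
      have "\<bar>2 * cdf x - cdf (x + \<sigma> * t) - cdf (x - \<sigma> * t)\<bar> \<le> 2"
        using cdf_le_1[of x] cdf_le_1[of "x + \<sigma> * t"] cdf_le_1[of "x - \<sigma> * t"]
          cdf_nonneg[of x] cdf_nonneg[of "x + \<sigma> * t"] cdf_nonneg[of "x - \<sigma> * t"]
        by linarith
      then show ?thesis
        using Y0_pos by (simp add: velocity_def abs_mult mult.commute)
    qed
    have ac: "\<bar>acceleration t x\<bar> \<le> Y0 * \<sigma> * (\<rho> (x - \<sigma> * t) + \<rho> (x + \<sigma> * t))"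
      unfolding acceleration_def abs_mult
      using nonneg[of "x - \<sigma> * t"] nonneg[of "x + \<sigma> * t"] Y0_pos sigma_pos
      by (intro mult_mono) (auto simp: abs_if)
    have sr: "\<bar>strain_rate t x\<bar> \<le> Y0 * (2 * \<rho> x + \<rho> (x - \<sigma> * t) + \<rho> (x + \<sigma> * t))"
      unfolding strain_rate_def abs_mult
      using nonneg[of "x - \<sigma> * t"] nonneg[of "x + \<sigma> * t"] nonneg[of x] Y0_pos
      by (intro mult_mono) (auto simp: abs_if)
    have "\<bar>energy_rate t x\<bar> \<le> \<bar>velocity t x\<bar> * \<bar>acceleration t x\<bar> + \<bar>\<tau> (strain t x)\<bar> * \<bar>strain_rate t x\<bar>"
      unfolding energy_rate_def by (metis abs_mult abs_triangle_ineq)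
    also have "\<dots> \<le> (2 * Y0) * (Y0 * \<sigma> * (\<rho> (x - \<sigma> * t) + \<rho> (x + \<sigma> * t)))
        + M * (Y0 * (2 * \<rho> x + \<rho> (x - \<sigma> * t) + \<rho> (x + \<sigma> * t)))"
      using v ac sr abs_tau_le[OF strain_ge[OF assms(1)]] M Y0_pos unfolding M_def
      by (intro add_mono mult_mono) auto
    also have "\<dots> = g x"
      by (simp add: g_def k_def power2_eq_square algebra_simps)
    finally show "norm (energy_rate t x) \<le> g x" by simp
  qed (use g energy_rate_integrable assms in auto)
  also have "\<dots> \<le> k * 1 + k * 1 + 2 * M * Y0 * 1"
    unfolding integral_unique[OF g]
    using M k Y0_pos by (intro add_mono mult_left_mono cdf_diff_le) auto
  also have "\<dots> = rate_bound"
    by (simp add: rate_bound_def k_def M_def Let_def)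
  finally show ?thesis by simp
qed

section \<open>Splitting the energy rate into crack and shock parts\<close>

text \<open>The stress power near 0 once both fronts have left the support of \<open>\<rho>\<close>:
  the strain there is \<open>\<alpha>\<close> plus the smeared crack opening, and the acceleration
  vanishes.\<close>

definition crack_density :: "real \<Rightarrow> real \<Rightarrow> real" where
  "crack_density t x = \<tau> (\<alpha> + 2 * \<rho> x * t * Y0) * (2 * Y0 * \<rho> x)"

text \<open>Near \<open>x = \<plusminus>\<sigma>t\<close> velocity and strain are travelling waves, whose energy rate is \<open>\<minusplus>\<sigma>\<close> times an
  \<open>x\<close>-derivative.\<close>

definition shock_primitive :: "real \<Rightarrow> real \<Rightarrow> real" where
  "shock_primitive t x =
    \<sigma> * (stored_energy \<tau> (lam - (lam - \<alpha>) * cdf (x + \<sigma> * t))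
      - stored_energy \<tau> (lam - (lam - \<alpha>) * (1 - cdf (x - \<sigma> * t))))
    + \<sigma> * Y0\<^sup>2 / 2 * ((cdf (x + \<sigma> * t))\<^sup>2 - (1 - cdf (x - \<sigma> * t))\<^sup>2)"

text \<open>The hypothesis separates the supports of the kernels at 0 and
  \<open>\<plusminus>\<sigma>t\<close>, so the energy rate can be compared with the chain-rule
  derivative region by region.\<close>

lemma DERIV_shock_primitive:
  assumes "2 * \<epsilon> < \<sigma> * t"
  shows "(shock_primitive t has_real_derivative energy_rate t x - crack_density t x) (at x)"
proof -
  have "(lam - \<alpha>) * cdf z \<le> (lam - \<alpha>) * 1" for z
    using alpha_less cdf_le_1 by (intro mult_left_mono) auto
  moreover have "(lam - \<alpha>) * (1 - cdf z) \<le> (lam - \<alpha>) * 1" for z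
    using alpha_less cdf_nonneg by (intro mult_left_mono) auto
  ultimately have pos: "0 < lam - (lam - \<alpha>) * cdf z" "0 < lam - (lam - \<alpha>) * (1 - cdf z)" for z
    using alpha_pos by (smt (verit) mult_cancel_left1)+
  define D where "D =
      \<sigma> * (\<tau> (lam - (lam - \<alpha>) * cdf (x + \<sigma> * t)) * (- (lam - \<alpha>) * \<rho> (x + \<sigma> * t))
        - \<tau> (lam - (lam - \<alpha>) * (1 - cdf (x - \<sigma> * t))) * ((lam - \<alpha>) * \<rho> (x - \<sigma> * t)))
      + \<sigma> * Y0\<^sup>2 * (cdf (x + \<sigma> * t) * \<rho> (x + \<sigma> * t) + (1 - cdf (x - \<sigma> * t)) * \<rho> (x - \<sigma> * t))"
  have "(shock_primitive t has_real_derivative D) (at x)"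
    unfolding D_def shock_primitive_def[abs_def]
    by (rule derivative_eq_intros DERIV_chain2[OF DERIV_stored_energy] pos refl)+
      (simp add: algebra_simps)
  moreover have "D = energy_rate t x - crack_density t x"
  proof -
    \<comment> \<open>Near the crack \<open>D\<close> vanishes. To the right the velocity is
      \<open>Y0 * (1 - cdf (x - \<sigma> * t))\<close>, to the left
      \<open>- Y0 * cdf (x + \<sigma> * t)\<close>: the travelling waves built into
      \<open>shock_primitive\<close>.\<close>
    consider "\<bar>x\<bar> \<le> \<epsilon>" | "\<epsilon> < x" | "x < - \<epsilon>" by linarith
    then show ?thesis
    proof cases
      case 1
      then have "\<rho> (x + \<sigma> * t) = 0" "\<rho> (x - \<sigma> * t) = 0" "cdf (x + \<sigma> * t) = 1" "cdf (x - \<sigma> * t) = 0"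
        using assms by (auto intro!: vanish cdf_eq_0 cdf_eq_1)
      then show ?thesis
        by (simp add: D_def energy_rate_def crack_density_def acceleration_def strain_def strain_rate_def ac_simps)
    next
      case 2
      then have "\<rho> x = 0" "\<rho> (x + \<sigma> * t) = 0" "cdf x = 1" "cdf (x + \<sigma> * t) = 1"
        using assms radius by (auto intro!: vanish cdf_eq_0 cdf_eq_1)
      then show ?thesis
        unfolding D_def energy_rate_def crack_density_def acceleration_def velocity_def
          strain_def strain_rate_def
        unfolding Y0_eq
        by (simp add: power2_eq_square algebra_simps)
    next
      case 3
      then have "\<rho> x = 0" "\<rho> (x - \<sigma> * t) = 0" "cdf x = 0" "cdf (x - \<sigma> * t) = 0"
        using assms radius by (auto intro!: vanish cdf_eq_0 cdf_eq_1)
      then show ?thesis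
        unfolding D_def energy_rate_def crack_density_def acceleration_def velocity_def
          strain_def strain_rate_def
        unfolding Y0_eq
        by (simp add: power2_eq_square algebra_simps)
    qed
  qed
  ultimately show ?thesis by simp
qed

lemma continuous_on_crack_density:
  assumes "0 \<le> t" shows "continuous_on A (crack_density t)"
proof -
  have "0 \<le> 2 * \<rho> x * t * Y0" for x
    using assms nonneg Y0_pos by simp
  then have "0 < \<alpha> + 2 * \<rho> x * t * Y0" for x
    using alpha_pos by (simp add: add_pos_nonneg)
  then have "continuous_on A (\<lambda>x. \<tau> (\<alpha> + 2 * \<rho> x * t * Y0))"
    by (intro continuous_on_compose2[OF tau_continuous] continuous_intros) auto
  then show ?thesis
    unfolding crack_density_def[abs_def] by (intro continuous_intros)
qed

text \<open>The interval contains both smeared fronts, so at \<open>\<plusminus>r\<close> every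
  \<open>cdf\<close> in the primitive is 0 or 1, and its boundary values involve only the states
  \<open>\<alpha>\<close> and \<open>lam\<close>.\<close>

lemma integral_energy_rate:
  assumes "2 * \<epsilon> < \<sigma> * t" "\<sigma> * t + \<epsilon> \<le> r"
  shows "integral {- r..r} (energy_rate t) =
    2 * \<sigma> * (1/2 * Y0\<^sup>2 + stored_energy \<tau> \<alpha> - stored_energy \<tau> lam)
    + integral {- \<epsilon>..\<epsilon>} (crack_density t)"
proof -
  have t: "0 \<le> t"
    using assms(1) radius sigma_pos by (smt (verit) mult_pos_neg)
  have r: "- r \<le> r" using assms radius by linarith
  have "((\<lambda>x. energy_rate t x - crack_density t x) has_integral
      shock_primitive t r - shock_primitive t (- r)) {- r..r}"
    using DERIV_shock_primitive[OF assms(1)] r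
    by (intro fundamental_theorem_of_calculus)
      (auto intro: has_field_derivative_at_within
        simp flip: has_real_derivative_iff_has_vector_derivative)
  moreover have "shock_primitive t r - shock_primitive t (- r) =
      2 * \<sigma> * (1/2 * Y0\<^sup>2 + stored_energy \<tau> \<alpha> - stored_energy \<tau> lam)"
  proof -
    have "cdf (r + \<sigma> * t) = 1" "cdf (r - \<sigma> * t) = 1"
      "cdf (- r + \<sigma> * t) = 0" "cdf (- r - \<sigma> * t) = 0"
      using assms radius by (auto intro!: cdf_eq_0 cdf_eq_1)
    then show ?thesis by (simp add: shock_primitive_def algebra_simps)
  qed
  moreover have "integral {- r..r} (crack_density t) = integral {- \<epsilon>..\<epsilon>} (crack_density t)"
    using assms radius
    by (intro integral_spike_set negligible_subset[OF negligible_empty] subset_antisym)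
      (use support in \<open>force simp: crack_density_def abs_le_iff\<close>)+
  moreover have "integral {- r..r} (\<lambda>x. energy_rate t x - crack_density t x) =
      integral {- r..r} (energy_rate t) - integral {- r..r} (crack_density t)"
    using t by (intro integral_diff energy_rate_integrable integrable_continuous_real
        continuous_on_crack_density)
  ultimately show ?thesis
    by (simp add: has_integral_iff)
qed

section \<open>Integration of the energy rate in time\<close>

lemma integral_energy_density_eq:
  assumes "0 \<le> t"
  shows "(\<lambda>s. integral {a..b} (energy_rate s)) integrable_on {0..t}"
    and "integral {a..b} (energy_density t) = integral {a..b} (energy_density 0)
      + integral {0..t} (\<lambda>s. integral {a..b} (energy_rate s))"
proof -
  have "((\<lambda>s. integral {a..b} (energy_rate s)) has_integral
      integral {a..b} (energy_density t) - integral {a..b} (energy_density 0)) {0..t}"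
    using assms
    by (intro fundamental_theorem_of_calculus)
      (auto intro!: DERIV_subset[OF DERIV_integral_energy_density]
        simp flip: has_real_derivative_iff_has_vector_derivative)
  then show "(\<lambda>s. integral {a..b} (energy_rate s)) integrable_on {0..t}"
    "integral {a..b} (energy_density t) = integral {a..b} (energy_density 0)
      + integral {0..t} (\<lambda>s. integral {a..b} (energy_rate s))"
    by (auto simp: has_integral_iff)
qed

lemma energy_density_0: "energy_density 0 x = stored_energy \<tau> lam"
  by (simp add: energy_density_def velocity_def strain_def)

end


lemma (in fan) crack_power_eq:
  assumes "0 \<le> t"
  shows "(LINT x:{- \<epsilon>..\<epsilon>}|lborel. crack_density t x) = integral {- \<epsilon>..\<epsilon>} (crack_density t)"
  using assms
  by (intro set_borel_integral_eq_integral(2) borel_integrable_atLeastAtMost' continuous_on_crack_density)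

section \<open>Rescaled mollifiers and the limit of the crack term\<close>

lemma mollifier_kernel:
  assumes "mollifier \<phi>" "1 \<le> n"
  shows "kernel (rescaled \<phi> n) (1 / real n)"
proof
  have "\<phi> differentiable (at x)" for x
    using assms(1) unfolding mollifier_def smooth_def by (metis funpow_0)
  then have "continuous_on UNIV \<phi>"
    by (simp add: continuous_on_eq_continuous_at differentiable_imp_continuous_within)
  then show "continuous_on UNIV (rescaled \<phi> n)"
    unfolding rescaled_def[abs_def]
    by (auto intro!: continuous_intros intro: continuous_on_compose2)
  have zero: "\<phi> x = 0" if "1 < \<bar>x\<bar>" for x
    using assms(1) that closure_subset[of "{x. \<phi> x \<noteq> 0}"]
    by (force simp: mollifier_def)
  show "0 \<le> rescaled \<phi> n x" "rescaled \<phi> n (- x) = rescaled \<phi> n x" for x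
    using assms by (auto simp: rescaled_def mollifier_def)
  show "rescaled \<phi> n x = 0" if "1 / real n < \<bar>x\<bar>" for x
    using that assms(2) by (simp add: rescaled_def zero abs_mult field_simps)
  have "1 = \<bar>real n\<bar> *\<^sub>R (LINT x|lborel. \<phi> (0 + real n * x))"
    using assms by (subst lborel_integral_real_affine[symmetric]) (auto simp: mollifier_def)
  then show "(LINT x|lborel. rescaled \<phi> n x) = 1"
    by (simp add: rescaled_def)
qed (use assms in simp)

text \<open>After the substitution \<open>u = n * x\<close> the strain grows without bound wherever
  \<open>\<phi> u\<close> is positive, so the stress tends to \<open>\<tau>_inf\<close>; where
  \<open>\<phi> u\<close> is 0 the integrand vanishes. The remaining factor integrates to
  \<open>2 * Y0\<close>.\<close>

lemma (in bar) crack_integral_tendsto: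
  assumes "mollifier \<phi>" "0 < t"
  shows "(\<lambda>n. integral {- (1 / real n)..1 / real n} (fan.crack_density (rescaled \<phi> n) \<tau> \<alpha> Y0 t))
    \<longlonglongrightarrow> 2 * Y0 * \<tau>_inf"
proof -
  \<comment> \<open>The unscaled mollifier is its own rescaling with \<open>n = 1\<close>.\<close>
  interpret K: kernel \<phi> 1
    using mollifier_kernel[OF assms(1), of 1] by (simp add: rescaled_def[abs_def])
  define f where "f = (\<lambda>(n::nat) u. \<tau> (\<alpha> + 2 * (real n * \<phi> u) * t * Y0) * (2 * Y0 * \<phi> u))"
  define h where "h = (\<lambda>u. max \<bar>\<tau> \<alpha>\<bar> \<bar>\<tau>_inf\<bar> * (2 * Y0 * \<phi> u))"
  have ge: "\<alpha> \<le> \<alpha> + 2 * (real n * \<phi> u) * t * Y0" for n u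
    using K.nonneg[of u] assms(2) Y0_pos by simp
  have f_int: "f n integrable_on {-1..1}" for n
  proof -
    have "continuous_on {-1..1} (\<lambda>u. \<tau> (\<alpha> + 2 * (real n * \<phi> u) * t * Y0))"
      using ge alpha_pos
      by (intro continuous_on_compose2[OF tau_continuous] continuous_intros)
        (auto intro: less_le_trans intro!: continuous_intros)
    then show ?thesis
      unfolding f_def by (intro integrable_continuous_real continuous_intros)
  qed
  have int_\<phi>: "(\<phi> has_integral 1) {-1..1}"
    using K.has_integral_shifted[of "-1" 1 0] K.cdf_eq_0[of "-1"] K.cdf_eq_1[of 1] by simp
  have *: "(\<lambda>n. integral {-1..1} (f n)) \<longlonglongrightarrow> integral {-1..1} (\<lambda>u. \<tau>_inf * (2 * Y0 * \<phi> u))"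
  proof (rule dominated_convergence(2))
    fix n
    show "f n integrable_on {-1..1}" by (rule f_int)
    show "norm (f n u) \<le> h u" for u
      using abs_tau_le[OF ge[of n u]] K.nonneg[of u] Y0_pos
      unfolding f_def h_def by (simp add: abs_mult mult_right_mono)
  next
    show "h integrable_on {-1..1}"
      unfolding h_def by (intro integrable_continuous_real continuous_intros)
  next
    show "(\<lambda>n. f n u) \<longlonglongrightarrow> \<tau>_inf * (2 * Y0 * \<phi> u)" for u
    proof (cases "\<phi> u = 0")
      case False
      then have "0 < 2 * \<phi> u * t * Y0"
        using K.nonneg[of u] assms(2) Y0_pos by simp
      then have "filterlim (\<lambda>n. \<alpha> + (2 * \<phi> u * t * Y0) * real n) at_top sequentially"
        by (intro filterlim_tendsto_add_at_top[OF tendsto_const]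
            filterlim_tendsto_pos_mult_at_top[OF tendsto_const] filterlim_real_sequentially)
      then have "(\<lambda>n. \<tau> (\<alpha> + (2 * \<phi> u * t * Y0) * real n)) \<longlonglongrightarrow> \<tau>_inf"
        by (rule filterlim_compose[OF tau_tendsto])
      then have "(\<lambda>n. \<tau> (\<alpha> + (2 * \<phi> u * t * Y0) * real n) * (2 * Y0 * \<phi> u))
          \<longlonglongrightarrow> \<tau>_inf * (2 * Y0 * \<phi> u)"
        by (intro tendsto_mult tendsto_const)
      then show ?thesis by (simp add: f_def mult_ac)
    qed (simp add: f_def)
  qed
  have "integral {- (1 / real n)..1 / real n} (fan.crack_density (rescaled \<phi> n) \<tau> \<alpha> Y0 t)
      = integral {-1..1} (f n)" if n: "1 \<le> n" for n
  proof -
    interpret fan "rescaled \<phi> n" "1 / real n"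
      by (intro fan.intro mollifier_kernel assms n bar_axioms)
    have "(f n has_integral integral {-1..1} (f n)) {-1..1}"
      by (rule integrable_integral[OF f_int])
    moreover have "(\<lambda>x. x / real n) ` {-1..1} = {- (1 / real n)..1 / real n}"
      using n by (simp add: image_divide_atLeastAtMost)
    ultimately have "((\<lambda>x. f n (real n * x)) has_integral inverse (real n) * integral {-1..1} (f n))
        {- (1 / real n)..1 / real n}"
      using has_integral_stretch_real[of "f n" "integral {-1..1} (f n)" "-1" 1 "real n"] n
      by (simp add: divide_inverse)
    from has_integral_mult_right[OF this, of "real n"] n
    have "((\<lambda>x. real n * f n (real n * x)) has_integral integral {-1..1} (f n))
        {- (1 / real n)..1 / real n}"
      by (simp add: field_simps)
    \<comment> \<open>The Jacobian \<open>n\<close> of the substitution is the factor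
      \<open>n\<close> in \<open>rescaled\<close>.\<close>
    moreover have "real n * f n (real n * x) = crack_density t x" for x
      by (simp add: f_def crack_density_def rescaled_def mult_ac)
    ultimately show ?thesis by (simp add: has_integral_iff)
  qed
  then have ev: "\<forall>\<^sub>F n in sequentially.
      integral {- (1 / real n)..1 / real n} (fan.crack_density (rescaled \<phi> n) \<tau> \<alpha> Y0 t)
      = integral {-1..1} (f n)"
    using eventually_ge_at_top[of 1] by (rule eventually_mono[rotated])
  have "integral {-1..1} (\<lambda>u. \<tau>_inf * (2 * Y0 * \<phi> u)) = 2 * Y0 * \<tau>_inf"
    using integral_unique[OF int_\<phi>] by simp
  then show ?thesis
    using * unfolding tendsto_cong[OF ev] by (simp only:)
qed

section \<open>Inequalities behind the signs of the rates\<close>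

text \<open>View the error of the trapezoidal rule as a function of the right endpoint. By the mean
  value theorem for \<open>f\<close>, its derivative at \<open>z\<close> is
  \<open>(z - a) / 2\<close> times \<open>f' w - f' z\<close> for some \<open>w < z\<close>, which
  is positive because \<open>f'\<close> decreases.\<close>

lemma trapezoid_less_integral_of_concave:
  fixes f f' f'' F :: "real \<Rightarrow> real"
  assumes "a < b"
    and F: "\<And>x. a \<le> x \<Longrightarrow> x \<le> b \<Longrightarrow> (F has_real_derivative f x) (at x)"
    and f: "\<And>x. a \<le> x \<Longrightarrow> x \<le> b \<Longrightarrow> (f has_real_derivative f' x) (at x)"
    and f': "\<And>x. a \<le> x \<Longrightarrow> x \<le> b \<Longrightarrow> (f' has_real_derivative f'' x) (at x)"
    and neg: "\<And>x. a \<le> x \<Longrightarrow> x \<le> b \<Longrightarrow> f'' x < 0"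
  shows "(b - a) * (f a + f b) / 2 < F b - F a"
proof -
  define h where "h = (\<lambda>x. F x - F a - (x - a) * (f a + f x) / 2)"
  define h' where "h' = (\<lambda>x. (f x - f a) / 2 - (x - a) * f' x / 2)"
  have h: "(h has_real_derivative h' x) (at x)" if "a \<le> x" "x \<le> b" for x
    unfolding h_def h'_def using that
    by (auto intro!: derivative_eq_intros F f simp: field_simps)
  obtain z where z: "a < z" "z < b" "h b - h a = (b - a) * h' z"
    using MVT2[of a b h h'] assms(1) h by blast
  obtain w where w: "a < w" "w < z" "f z - f a = (z - a) * f' w"
    using MVT2[of a z f f'] f z by (metis dual_order.trans less_imp_le)
  have "f' z < f' w"
  proof (rule DERIV_neg_imp_decreasing[OF w(2)])
    fix x assume "w \<le> x" "x \<le> z"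
    then have "a \<le> x" "x \<le> b" using w z by linarith+
    then show "\<exists>y. (f' has_real_derivative y) (at x) \<and> y < 0" using f' neg by blast
  qed
  then have "(z - a) * f' z < (z - a) * f' w"
    using z by simp
  then have "0 < h' z" by (simp add: h'_def w(3))
  then have "0 < h b - h a" using assms(1) z by simp
  then show ?thesis by (simp add: h_def)
qed


text \<open>The mean stress between the two states is attained strictly before \<open>lam\<close>.
  This lets the crack work outweigh the dissipation.\<close>

lemma (in bar) stored_energy_diff_less:
  "stored_energy \<tau> lam - stored_energy \<tau> \<alpha> < (lam - \<alpha>) * \<tau> lam"
proof -
  obtain z where z: "\<alpha> < z" "z < lam"
    "stored_energy \<tau> lam - stored_energy \<tau> \<alpha> = (lam - \<alpha>) * \<tau> z"
    using MVT2[OF alpha_less, of "stored_energy \<tau>" \<tau>] DERIV_stored_energy alpha_pos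
    by (metis less_le_trans)
  then show ?thesis
    using tau_less[of z lam] alpha_pos by simp
qed

section \<open>Energy balance for each mollification and passage to the limit\<close>

theorem proposition2p5:
  fixes \<tau> \<phi> :: "real \<Rightarrow> real"
    and \<alpha> lam \<sigma> Y0 T0 r \<tau>_inf :: real
    and B :: "real set"
    and y :: "real \<Rightarrow> real \<Rightarrow> real"
  assumes tau_diff: "\<And>u. 0 < u \<Longrightarrow> \<tau> differentiable (at u)"
    and tau_diff2: "\<And>u. 0 < u \<Longrightarrow> deriv \<tau> differentiable (at u)"
    and tau_incr: "\<And>u. 0 < u \<Longrightarrow> 0 < deriv \<tau> u"
    and tau_conc: "\<And>u. 0 < u \<Longrightarrow> deriv (deriv \<tau>) u < 0"
    and tau_zero: "filterlim \<tau> at_bot (at_right 0)"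
    and W_zero: "filterlim (stored_energy \<tau>) at_top (at_right 0)"
    and pos: "0 < \<alpha>" "0 < lam" "0 < \<sigma>" "0 < Y0" "\<alpha> < lam"
    and Y0_eq: "Y0 = (lam - \<alpha>) * \<sigma>"
    and sigma_eq: "\<sigma> = sqrt ((\<tau> lam - \<tau> \<alpha>) / (lam - \<alpha>))"
    and y_eq: "y = motion \<alpha> lam \<sigma> Y0"
    and moll: "mollifier \<phi>"
    and T0: "0 < T0"
    and r: "\<sigma> * T0 + 1 < r"
    and B_eq: "B = {-r<..<r}"
    and tau_inf: "(\<tau> \<longlongrightarrow> \<tau>_inf) at_top"
  shows "(\<exists>e :: nat \<Rightarrow> real \<Rightarrow> real.
            (\<exists>C. \<forall>n\<ge>1. \<forall>t. 0 < t \<and> t \<le> T0 \<and> t < 2 / (real n * \<sigma>) \<longrightarrow> \<bar>e n t\<bar> \<le> C) \<and>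
            (\<forall>n\<ge>1. \<forall>t. 0 < t \<and> t \<le> T0 \<and> t \<noteq> 2 / (real n * \<sigma>) \<longrightarrow>
               ((\<lambda>s. energy \<tau> (mollified \<phi> n y) B s) has_real_derivative
                  (mu_left \<tau> \<alpha> lam \<sigma> Y0 + mu_right \<tau> \<alpha> lam \<sigma> Y0 + crack_power \<tau> \<phi> \<alpha> Y0 n t)
                    * of_bool (2 / (real n * \<sigma>) < t)
                  + e n t * of_bool (0 < t \<and> t < 2 / (real n * \<sigma>))) (at t)))
       \<and> (\<forall>t. 0 < t \<and> t \<le> T0 \<longrightarrow>
            convergent (\<lambda>n. energy \<tau> (mollified \<phi> n y) B t) \<and>
            limit_energy \<tau> \<phi> y B t - homogeneous_energy \<tau> lam B
              = (LBINT s=ereal 0..ereal t. total_rate \<tau> \<tau>_inf \<alpha> lam \<sigma> Y0) \<and>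
            0 < (LBINT s=ereal 0..ereal t. total_rate \<tau> \<tau>_inf \<alpha> lam \<sigma> Y0))
       \<and> mu_left \<tau> \<alpha> lam \<sigma> Y0 < 0 \<and> mu_right \<tau> \<alpha> lam \<sigma> Y0 < 0
       \<and> 0 < limit_crack_power \<tau> \<tau>_inf \<alpha> Y0
       \<and> 0 < total_rate \<tau> \<tau>_inf \<alpha> lam \<sigma> Y0"
proof -
  let ?W = "stored_energy \<tau>"
  let ?T = "total_rate \<tau> \<tau>_inf \<alpha> lam \<sigma> Y0"
  have D\<tau>: "(\<tau> has_real_derivative deriv \<tau> u) (at u)" if "0 < u" for u
    using tau_diff[OF that] by (simp add: DERIV_deriv_iff_real_differentiable)
  have D2\<tau>: "(deriv \<tau> has_real_derivative deriv (deriv \<tau>) u) (at u)" if "0 < u" for u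
    using tau_diff2[OF that] by (simp add: DERIV_deriv_iff_real_differentiable)
  interpret bar \<tau> \<alpha> lam \<sigma> Y0 \<tau>_inf
  proof
    show "continuous_on {0<..} \<tau>"
      by (rule DERIV_continuous_on[of _ _ "deriv \<tau>"])
        (auto intro: has_field_derivative_at_within D\<tau>)
    show "\<tau> u < \<tau> v" if "0 < u" "u < v" for u v
    proof (rule DERIV_pos_imp_increasing[OF that(2)])
      fix x assume "u \<le> x"
      then show "\<exists>y. (\<tau> has_real_derivative y) (at x) \<and> 0 < y"
        using that D\<tau>[of x] tau_incr[of x] by auto
    qed
  qed (use pos Y0_eq tau_inf in auto)
  have sigma2: "\<sigma>\<^sup>2 * (lam - \<alpha>) = \<tau> lam - \<tau> \<alpha>"
    using pos tau_less[of \<alpha> lam] unfolding sigma_eq by simp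
  have trapezoid: "(lam - \<alpha>) * (\<tau> \<alpha> + \<tau> lam) / 2 < ?W lam - ?W \<alpha>"
    using pos tau_conc
    by (intro trapezoid_less_integral_of_concave[of _ _ ?W \<tau> "deriv \<tau>" "deriv (deriv \<tau>)"]
        DERIV_stored_energy D\<tau> D2\<tau>) auto
  \<comment> \<open>The jump relation \<open>sigma2\<close> turns the kinetic term into
    \<open>(lam - \<alpha>) * (\<tau> lam - \<tau> \<alpha>) / 2\<close>; together with the
    \<open>Y0 * \<tau> \<alpha>\<close> term this gives the trapezoidal rule minus the exact
    integral of \<open>\<tau>\<close>.\<close>
  have "\<sigma> * (1/2 * Y0\<^sup>2 + ?W \<alpha> - ?W lam) + Y0 * \<tau> \<alpha>
      = \<sigma> * ((lam - \<alpha>) * (\<sigma>\<^sup>2 * (lam - \<alpha>)) / 2 + (lam - \<alpha>) * \<tau> \<alpha> - (?W lam - ?W \<alpha>))"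
    by (simp add: Y0_eq power2_eq_square algebra_simps add_divide_distrib diff_divide_distrib)
  also have "\<dots> = \<sigma> * ((lam - \<alpha>) * (\<tau> \<alpha> + \<tau> lam) / 2 - (?W lam - ?W \<alpha>))"
    unfolding sigma2 by (simp add: field_simps)
  finally have mu_eq: "\<sigma> * (1/2 * Y0\<^sup>2 + ?W \<alpha> - ?W lam) + Y0 * \<tau> \<alpha>
      = \<sigma> * ((lam - \<alpha>) * (\<tau> \<alpha> + \<tau> lam) / 2 - (?W lam - ?W \<alpha>))" .
  have mu_neg: "mu_left \<tau> \<alpha> lam \<sigma> Y0 < 0" "mu_right \<tau> \<alpha> lam \<sigma> Y0 < 0"
    unfolding mu_left_def mu_right_def mu_eq using pos trapezoid by (simp_all add: mult_pos_neg)
  have inf: "\<tau> \<alpha> < \<tau> lam" "\<tau> lam \<le> \<tau>_inf"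
    using pos tau_less[of \<alpha> lam] tau_le_inf[of lam] by auto
  have crack_pos: "0 < limit_crack_power \<tau> \<tau>_inf \<alpha> Y0"
    using inf pos by (simp add: limit_crack_power_def)
  have T_pos: "0 < ?T"
  proof -
    define L where "L = lam - \<alpha>"
    have L: "0 < L" using pos by (simp add: L_def)
    \<comment> \<open>The crack term is split at \<open>\<tau> lam\<close>, so that each of the
      three summands has a definite sign.\<close>
    have "?T = 2 * \<sigma> * ((L * \<tau> lam - (?W lam - ?W \<alpha>)) + L * (\<tau>_inf - \<tau> lam)
        + L * (\<tau> lam - \<tau> \<alpha>) / 2)"
      unfolding total_rate_def mu_left_def mu_right_def mu_eq
      unfolding limit_crack_power_def Y0_eq L_def
      by (simp add: field_simps)
    moreover have "0 < L * \<tau> lam - (?W lam - ?W \<alpha>)"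
      using stored_energy_diff_less by (simp add: L_def)
    moreover have "0 \<le> L * (\<tau>_inf - \<tau> lam)" "0 < L * (\<tau> lam - \<tau> \<alpha>) / 2"
      using L inf by simp_all
    ultimately show ?thesis using pos by (simp add: add_pos_nonneg add_pos_pos)
  qed
  \<comment> \<open>The locale constants are applied to explicit parameters so that \<open>n\<close>
    can vary. At \<open>n = 0\<close> the radius \<open>1 / real n\<close> is 0 and there is no
    kernel, hence the guards \<open>1 \<le> n\<close> below.\<close>
  define F where
    "F = (\<lambda>n t. integral {- r..r} (fan.energy_density (rescaled \<phi> n) (1 / real n) \<tau> \<alpha> lam \<sigma> Y0 t))"
  define D where
    "D = (\<lambda>n t. integral {- r..r} (fan.energy_rate (rescaled \<phi> n) (1 / real n) \<tau> \<alpha> lam \<sigma> Y0 t))"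
  have fan: "fan (rescaled \<phi> n) (1 / real n) \<tau> \<alpha> lam \<sigma> Y0 \<tau>_inf" if "1 \<le> n" for n
    by (intro fan.intro mollifier_kernel moll that bar_axioms)
  have r_pos: "0 < r" using r T0 pos by (smt (verit) mult_pos_pos)
  have energy: "energy \<tau> (mollified \<phi> n y) B t = F n t" if "1 \<le> n" "0 < t" for n t
  proof -
    interpret fan "rescaled \<phi> n" "1 / real n" using fan[OF that(1)] .
    have "mollified \<phi> n y x s = position s x" if "0 < s" for s x
      unfolding mollified_def y_eq position_def
      using that pos Y0_eq by (intro convolution_motion) auto
    then show ?thesis
      unfolding F_def B_eq using that(2) by (intro energy_eq) auto
  qed
  have bound: "\<bar>D n t\<bar> \<le> rate_bound" if "1 \<le> n" "0 \<le> t" for n t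
    unfolding D_def using fan.abs_integral_energy_rate_le[OF fan] that r_pos by simp
  have deriv: "((\<lambda>s. energy \<tau> (mollified \<phi> n y) B s) has_real_derivative D n t) (at t)"
    if "1 \<le> n" "0 < t" for n t
  proof -
    \<comment> \<open>Shrinking to the open half-line makes the one-sided derivative two-sided and
      stays where the energy equals \<open>F n\<close>.\<close>
    have "(F n has_real_derivative D n t) (at t within {0<..})"
      unfolding F_def D_def using that
      by (intro DERIV_subset[OF fan.DERIV_integral_energy_density[OF fan]]) auto
    then have "(F n has_real_derivative D n t) (at t)"
      using that by (simp add: at_within_open[of _ "{0<..}"])
    then show ?thesis
      using that by (elim has_field_derivative_transform_within_open[of _ _ _ "{0<..}"])
        (auto simp: energy)
  qed
  \<comment> \<open>Each \<open>\<mu>\<close> carries a term \<open>Y0 * \<tau> \<alpha>\<close>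
    that is missing from the boundary values; the subtraction in the crack power cancels the two of
    them.\<close>
  have D_eq: "D n t = mu_left \<tau> \<alpha> lam \<sigma> Y0 + mu_right \<tau> \<alpha> lam \<sigma> Y0
      + (integral {- (1 / real n)..1 / real n} (fan.crack_density (rescaled \<phi> n) \<tau> \<alpha> Y0 t)
      - 2 * Y0 * \<tau> \<alpha>)"
    if "1 \<le> n" "t \<le> T0" "2 / (real n * \<sigma>) < t" for n t
  proof -
    interpret fan "rescaled \<phi> n" "1 / real n" using fan[OF that(1)] .
    have "\<sigma> * t \<le> \<sigma> * T0" "1 / real n \<le> 1" using that pos by auto
    then have "\<sigma> * t + 1 / real n \<le> r" using r by linarith
    moreover have "2 * (1 / real n) < \<sigma> * t"
      using that pos by (simp add: field_simps)
    ultimately show ?thesis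
      unfolding D_def mu_left_def mu_right_def
      by (subst integral_energy_rate) (simp_all add: algebra_simps)
  qed
  have crack_eq: "crack_power \<tau> \<phi> \<alpha> Y0 n t =
      integral {- (1 / real n)..1 / real n} (fan.crack_density (rescaled \<phi> n) \<tau> \<alpha> Y0 t)
      - 2 * Y0 * \<tau> \<alpha>" if "1 \<le> n" "0 \<le> t" for n t
  proof -
    interpret fan "rescaled \<phi> n" "1 / real n" using fan[OF that(1)] .
    show ?thesis
      using crack_power_eq[OF that(2)] by (simp add: crack_power_def crack_density_def)
  qed
  have D_tendsto: "(\<lambda>n. D n s) \<longlonglongrightarrow> ?T" if "0 < s" "s \<le> T0" for s
  proof -
    have "(\<lambda>n. mu_left \<tau> \<alpha> lam \<sigma> Y0 + mu_right \<tau> \<alpha> lam \<sigma> Y0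
        + (integral {- (1 / real n)..1 / real n} (fan.crack_density (rescaled \<phi> n) \<tau> \<alpha> Y0 s)
        - 2 * Y0 * \<tau> \<alpha>)) \<longlonglongrightarrow> mu_left \<tau> \<alpha> lam \<sigma> Y0 + mu_right \<tau> \<alpha> lam \<sigma> Y0
        + (2 * Y0 * \<tau>_inf - 2 * Y0 * \<tau> \<alpha>)"
      by (intro tendsto_intros crack_integral_tendsto moll that)
    also have "mu_left \<tau> \<alpha> lam \<sigma> Y0 + mu_right \<tau> \<alpha> lam \<sigma> Y0
        + (2 * Y0 * \<tau>_inf - 2 * Y0 * \<tau> \<alpha>) = ?T"
      by (simp add: total_rate_def limit_crack_power_def algebra_simps)
    finally show ?thesis
    proof (rule Lim_transform_eventually)
      \<comment> \<open>For fixed \<open>s > 0\<close> the initial phase, in which the kernels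
        overlap, is eventually over before \<open>s\<close>.\<close>
      have "(\<lambda>n. 2 / (real n * \<sigma>)) \<longlonglongrightarrow> 0"
        using tendsto_mult_right_zero[OF lim_inverse_n, of "2 / \<sigma>"]
        by (simp add: divide_inverse mult_ac)
      then have "\<forall>\<^sub>F n in sequentially. 2 / (real n * \<sigma>) < s"
        using that(1) by (rule order_tendstoD)
      then show "\<forall>\<^sub>F n in sequentially. mu_left \<tau> \<alpha> lam \<sigma> Y0 + mu_right \<tau> \<alpha> lam \<sigma> Y0
        + (integral {- (1 / real n)..1 / real n} (fan.crack_density (rescaled \<phi> n) \<tau> \<alpha> Y0 s)
        - 2 * Y0 * \<tau> \<alpha>) = D n s"
        using eventually_ge_at_top[of 1] by eventually_elim (simp add: D_eq that)
    qed
  qed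
  have energy_tendsto: "(\<lambda>n. energy \<tau> (mollified \<phi> n y) B t) \<longlonglongrightarrow> 2 * r * ?W lam + t * ?T"
    if t: "0 < t" "t \<le> T0" for t
  \<comment> \<open>Dominated convergence needs its hypotheses for every index; the shift avoids
    \<open>n = 0\<close>.\<close>
  proof (rule LIMSEQ_imp_Suc)
    \<comment> \<open>The open interval leaves out \<open>s = 0\<close>, where velocity and strain
      rate vanish, so that \<open>D n 0\<close> is 0 and does not tend to the positive limit
      rate.\<close>
    have F_eq: "F n t = 2 * r * ?W lam + integral {0<..<t} (D n)"
      and D_int: "D n integrable_on {0<..<t}" if "1 \<le> n" for n
    proof -
      interpret fan "rescaled \<phi> n" "1 / real n" using fan[OF that] .
      have 0: "integral {- r..r} (energy_density 0) = 2 * r * ?W lam"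
        using r_pos by (simp add: energy_density_0[abs_def])
      have "integral {0..t} (D n) = integral {0<..<t} (D n)"
        using integral_open_interval[of 0 t "D n"] by simp
      then show "F n t = 2 * r * ?W lam + integral {0<..<t} (D n)"
        using integral_energy_density_eq(2)[of t "- r" r] t(1) 0 by (simp add: F_def D_def)
      show "D n integrable_on {0<..<t}"
        using integral_energy_density_eq(1)[of t "- r" r] t(1) integrable_on_open_interval[of "D n" 0 t]
        by (simp add: D_def)
    qed
    have "(\<lambda>n. integral {0<..<t} (D (Suc n))) \<longlonglongrightarrow> integral {0<..<t} (\<lambda>_. ?T)"
    proof (rule dominated_convergence(2))
      show "(\<lambda>_. rate_bound) integrable_on {0<..<t}"
        using integrable_on_open_interval[of "\<lambda>_. rate_bound" 0 t] integrable_const[of rate_bound 0 t]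
        by simp
      show "(\<lambda>n. D (Suc n) s) \<longlonglongrightarrow> ?T" if "s \<in> {0<..<t}" for s
        using that t by (intro LIMSEQ_Suc D_tendsto) auto
    qed (auto intro: D_int bound)
    also have "integral {0<..<t} (\<lambda>_. ?T) = t * ?T"
      using integral_open_interval[of 0 t "\<lambda>_. ?T"] t by simp
    finally have "(\<lambda>n. 2 * r * ?W lam + integral {0<..<t} (D (Suc n)))
        \<longlonglongrightarrow> 2 * r * ?W lam + t * ?T"
      by (intro tendsto_intros)
    then show "(\<lambda>n. energy \<tau> (mollified \<phi> (Suc n) y) B t) \<longlonglongrightarrow> 2 * r * ?W lam + t * ?T"
      using t by (simp add: energy F_eq)
  qed
  have homogeneous: "homogeneous_energy \<tau> lam B = 2 * r * ?W lam"
    using r_pos by (simp add: homogeneous_energy_def B_eq set_lebesgue_integral_def)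
  have rate_integral: "(LBINT s=ereal 0..ereal t. ?T) = t * ?T" if "0 < t" for t
    using that by (simp add: interval_integral_const)
  show ?thesis
  proof (intro conjI)
    \<comment> \<open>The witness for \<open>e\<close> is the full rate \<open>D n\<close>, bounded
      by \<open>rate_bound\<close> at all nonnegative times and thus in particular during the
      initial phase.\<close>
    have "(\<forall>n\<ge>1. \<forall>t. 0 < t \<and> t \<le> T0 \<and> t < 2 / (real n * \<sigma>) \<longrightarrow> \<bar>D n t\<bar> \<le> rate_bound)"
      using bound by simp
    moreover have "((\<lambda>s. energy \<tau> (mollified \<phi> n y) B s) has_real_derivative
        (mu_left \<tau> \<alpha> lam \<sigma> Y0 + mu_right \<tau> \<alpha> lam \<sigma> Y0 + crack_power \<tau> \<phi> \<alpha> Y0 n t)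
          * of_bool (2 / (real n * \<sigma>) < t)
        + D n t * of_bool (0 < t \<and> t < 2 / (real n * \<sigma>))) (at t)"
      if "1 \<le> n" "0 < t" "t \<le> T0" "t \<noteq> 2 / (real n * \<sigma>)" for n t
    proof (cases "2 / (real n * \<sigma>) < t")
      case True
      then show ?thesis
        using deriv[of n t] D_eq[of n t] crack_eq[of n t] that by simp
    next
      case False
      then show ?thesis using deriv[of n t] that by simp
    qed
    ultimately show "\<exists>e :: nat \<Rightarrow> real \<Rightarrow> real.
            (\<exists>C. \<forall>n\<ge>1. \<forall>t. 0 < t \<and> t \<le> T0 \<and> t < 2 / (real n * \<sigma>) \<longrightarrow> \<bar>e n t\<bar> \<le> C) \<and>
            (\<forall>n\<ge>1. \<forall>t. 0 < t \<and> t \<le> T0 \<and> t \<noteq> 2 / (real n * \<sigma>) \<longrightarrow>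
               ((\<lambda>s. energy \<tau> (mollified \<phi> n y) B s) has_real_derivative
                  (mu_left \<tau> \<alpha> lam \<sigma> Y0 + mu_right \<tau> \<alpha> lam \<sigma> Y0 + crack_power \<tau> \<phi> \<alpha> Y0 n t)
                    * of_bool (2 / (real n * \<sigma>) < t)
                  + e n t * of_bool (0 < t \<and> t < 2 / (real n * \<sigma>))) (at t))"
      by blast
    show "\<forall>t. 0 < t \<and> t \<le> T0 \<longrightarrow>
            convergent (\<lambda>n. energy \<tau> (mollified \<phi> n y) B t) \<and>
            limit_energy \<tau> \<phi> y B t - homogeneous_energy \<tau> lam B
              = (LBINT s=ereal 0..ereal t. total_rate \<tau> \<tau>_inf \<alpha> lam \<sigma> Y0) \<and>
            0 < (LBINT s=ereal 0..ereal t. total_rate \<tau> \<tau>_inf \<alpha> lam \<sigma> Y0)"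
      using energy_tendsto limI[OF energy_tendsto] T_pos rate_integral homogeneous
      by (auto simp: convergent_def limit_energy_def mult.commute)
  qed (use mu_neg crack_pos T_pos in auto)
qed

end
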